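(* Let $w>0$ and $c\ge 0$ be real numbers with $w-c+1>0$. Let $(n_i)_{i\ge 1}$ be independent, identically distributed random variables with $\Pr(n_i=n)=(1/2)^n$ for $n=1,2,3,\dots$, and set $$r_i=\frac{w-c+2^{\,n_i-1}}{w}\qquad (i\ge 1).$$ Then the time-average exponential growth rate $\bar g=\ln \bar r$, where $\bar r=\lim_{T\to\infty}\left(\prod_{i=1}^{T} r_i\right)^{1/T}$ (limit in the almost sure sense), is $$\bar g=\left(\sum_{n=1}^{\infty}\left(\frac12\right)^{n}\ln\left(w-c+2^{\,n-1}\right)\right)-\ln(w).$$
   Context: The St. Petersburg lottery: in one round a fair coin is tossed until the first success; the number of tosses $n$ is geometrically distributed with parameter $1/2$, i.e. $\Pr(n)=(1/2)^n$ for $n\ge1$, and the payout is $2^{n-1}$. A player with wealth $w$ before the round pays a ticket price $c$. The growth factor of round $i$, with payout $m_i=2^{n_i-1}$, is $r_i=(w-c+m_i)/w$, the factor by which wealth changes in that round. All rounds are equivalent: the same values of $w$ and $c$ enter every $r_i$, and the rounds are independent. After $T$ rounds wealth has changed by the factor $\prod_{i=1}^T r_i$. The finite-time average growth factor is $\bar r_T=\left(\prod_{i=1}^T r_i\right)^{1/T}$, the time-average growth factor is $\bar r=\lim_{T\to\infty}\bar r_T$, and the time-average exponential growth rate is $\bar g=\ln\bar r$. *)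

theory Defs
  imports "HOL-Probability.Probability"
begin

(* The number of tosses n is positive; at n = 0 the truncated subtraction gives
   the payout 1, but that value is attained with probability 0. *)
definition payout :: "nat \<Rightarrow> real" where
  "payout n = 2 ^ (n - 1)"

definition growth_factor :: "real \<Rightarrow> real \<Rightarrow> nat \<Rightarrow> real" where
  "growth_factor w c n = (w - c + payout n) / w"

(* A sequence r of per-round growth factors is indexed from 1; r 0 is never used. *)
definition finite_time_avg_growth_factor :: "(nat \<Rightarrow> real) \<Rightarrow> nat \<Rightarrow> real" where
  "finite_time_avg_growth_factor r T = (\<Prod>i=1..T. r i) powr (1 / real T)"

(* lim is an unspecified real if the sequence diverges, and ln is meant for positive
   arguments, so convergence and positivity of the limit have to be stated separately. *)
definition time_avg_growth_factor :: "(nat \<Rightarrow> real) \<Rightarrow> real" where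
  "time_avg_growth_factor r = lim (finite_time_avg_growth_factor r)"

definition time_avg_growth_rate :: "(nat \<Rightarrow> real) \<Rightarrow> real" where
  "time_avg_growth_rate r = ln (time_avg_growth_factor r)"

end

theory Submission
  imports Defs "HOL-Library.Discrete_Functions" "HOL-Real_Asymp.Real_Asymp"
begin

text \<open>
  The logarithm turns the finite-time average growth factor into the exponential of the
  arithmetic mean of the independent, identically distributed variables
  \<open>ln (w - c + payout (N i)) - ln w\<close>, so the growth rate is their common expectation as
  soon as a strong law of large numbers applies to them. Although the payout has infinite
  expectation, \<open>ln (w - c + payout n)\<close> grows only linearly in the number \<open>n\<close> of
  tosses while the probabilities decay geometrically; hence this logarithm has a finite second
  moment (\<open>summable_log_payout\<close>), and its expectation is the series in the statement
  (\<open>expectation_of_tosses\<close>). Since the payout is at least 1, it is moreover bounded below by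
  \<open>ln (w - c + 1)\<close>.

  These two properties suffice for an elementary strong law
  (\<open>strong_law_bounded_below\<close>). By independence the mean of the first \<open>n\<close> terms has
  variance \<open>O(1/n)\<close>. Along the squares \<open>n = k\<^sup>2\<close> these variances are summable, which forces
  almost sure convergence of that subsequence
  (\<open>AE_tendsto_of_summable_second_moments\<close>). After subtraction of the lower bound the
  partial sums are nondecreasing, so the means between two consecutive squares are squeezed by the
  means at the squares, and \<open>k\<^sup>2 / (k+1)\<^sup>2 \<longlonglongrightarrow> 1\<close> gives convergence of the whole sequence
  (\<open>averages_tendsto_of_square_subsequence\<close>).
\<close>

section \<open>A strong law of large numbers\<close>

text \<open>
  For \<open>k\<^sup>2 \<le> n \<le> (k+1)\<^sup>2\<close> monotonicity puts \<open>S n / n\<close> between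
  \<open>S (k\<^sup>2) / (k+1)\<^sup>2\<close> and \<open>S ((k+1)\<^sup>2) / k\<^sup>2\<close>. Both bounds differ from the averages at
  the squares by a factor that tends to 1.
\<close>
lemma averages_tendsto_of_square_subsequence:
  fixes S :: "nat \<Rightarrow> real"
  assumes mono: "incseq S" and nonneg: "S 0 \<ge> 0"
    and lim: "(\<lambda>k. S (k\<^sup>2) / real (k\<^sup>2)) \<longlonglongrightarrow> L"
  shows "(\<lambda>n. S n / real n) \<longlonglongrightarrow> L"
proof -
  define avg where "avg k = S (k\<^sup>2) / real (k\<^sup>2)" for k
  define lower where "lower k = avg k * (real k / real (Suc k))\<^sup>2" for k
  define upper where "upper k = avg (Suc k) * (real (Suc k) / real k)\<^sup>2" for k
  have S_nonneg: "S n \<ge> 0" for n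
    using nonneg incseqD[OF mono, of 0 n] by simp
  have avg: "avg \<longlonglongrightarrow> L"
    using lim unfolding avg_def .
  have "(\<lambda>k. (real k / real (Suc k))\<^sup>2) \<longlonglongrightarrow> 1"
    by real_asymp
  from tendsto_mult[OF avg this] have lower: "lower \<longlonglongrightarrow> L"
    unfolding lower_def by simp
  have "(\<lambda>k. (real (Suc k) / real k)\<^sup>2) \<longlonglongrightarrow> 1"
    by real_asymp
  from tendsto_mult[OF LIMSEQ_Suc[OF avg] this] have upper: "upper \<longlonglongrightarrow> L"
    unfolding upper_def by simp
  have root: "filterlim floor_sqrt at_top sequentially"
    unfolding filterlim_at_top
  proof
    fix k
    show "eventually (\<lambda>n. k \<le> floor_sqrt n) sequentially"
      using eventually_ge_at_top[of "k\<^sup>2"] by eventually_elim (rule le_floor_sqrtI)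
  qed
  have sandwich: "lower (floor_sqrt n) \<le> S n / real n \<and> S n / real n \<le> upper (floor_sqrt n)"
    if "n \<ge> 1" for n
  proof -
    define k where "k = floor_sqrt n"
    have k: "k > 0" "k\<^sup>2 \<le> n" "n \<le> (Suc k)\<^sup>2"
      using that Suc_floor_sqrt_power2_gt[of n] by (auto simp: k_def)
    have "lower k = S (k\<^sup>2) / real ((Suc k)\<^sup>2)"
      using k(1) by (simp add: lower_def avg_def power_divide)
    also have "\<dots> \<le> S n / real n"
      using k that S_nonneg by (intro frac_le incseqD[OF mono] of_nat_mono) auto
    finally have 1: "lower k \<le> S n / real n" .
    have "S n / real n \<le> S ((Suc k)\<^sup>2) / real (k\<^sup>2)"
      using k that S_nonneg by (intro frac_le incseqD[OF mono] of_nat_mono) auto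
    also have "\<dots> = upper k"
      using k(1) by (simp add: upper_def avg_def power_divide del: of_nat_Suc)
    finally show ?thesis
      using 1 by (simp add: k_def)
  qed
  show ?thesis
  proof (rule tendsto_sandwich)
    show "eventually (\<lambda>n. lower (floor_sqrt n) \<le> S n / real n) sequentially"
      using eventually_ge_at_top[of 1] by eventually_elim (use sandwich in blast)
    show "eventually (\<lambda>n. S n / real n \<le> upper (floor_sqrt n)) sequentially"
      using eventually_ge_at_top[of 1] by eventually_elim (use sandwich in blast)
  qed (use filterlim_compose[OF lower root] filterlim_compose[OF upper root] in auto)
qed

context prob_space
begin

text \<open>
  The mixed terms vanish: each summand is independent of the sum of the others, so the expectation
  of their product is the product of their expectations, which is 0.
\<close>
lemma second_moment_sum_centered_indep:
  fixes D :: "'i \<Rightarrow> 'a \<Rightarrow> real"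
  assumes "finite I" and "indep_vars (\<lambda>_. borel) D I"
    and "\<And>i. i \<in> I \<Longrightarrow> integrable M (\<lambda>\<omega>. (D i \<omega>)\<^sup>2)"
    and "\<And>i. i \<in> I \<Longrightarrow> expectation (D i) = 0"
  shows "integrable M (\<lambda>\<omega>. (\<Sum>i\<in>I. D i \<omega>)\<^sup>2)
    \<and> expectation (\<lambda>\<omega>. (\<Sum>i\<in>I. D i \<omega>)\<^sup>2) = (\<Sum>i\<in>I. expectation (\<lambda>\<omega>. (D i \<omega>)\<^sup>2))"
  using assms
proof (induction I rule: finite_induct)
  case empty
  show ?case by simp
next
  case (insert i I)
  define S where "S \<omega> = (\<Sum>j\<in>I. D j \<omega>)" for \<omega>
  have IH: "integrable M (\<lambda>\<omega>. (S \<omega>)\<^sup>2)"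
    "expectation (\<lambda>\<omega>. (S \<omega>)\<^sup>2) = (\<Sum>j\<in>I. expectation (\<lambda>\<omega>. (D j \<omega>)\<^sup>2))"
    using insert.IH[OF indep_vars_subset[OF insert.prems(1)]] insert.prems(2,3)
    unfolding S_def by auto
  have D2: "integrable M (\<lambda>\<omega>. (D i \<omega>)\<^sup>2)" and D0: "expectation (D i) = 0"
    using insert.prems(2,3) by auto
  have indep: "indep_var borel (D i) borel S"
    using indep_vars_sum[OF insert.hyps insert.prems(1)] unfolding S_def .
  have rv: "D i \<in> borel_measurable M" "S \<in> borel_measurable M"
    using indep_var_rv1[OF indep] indep_var_rv2[OF indep] by auto
  have int: "integrable M (D i)" "integrable M S"
    using rv D2 IH(1) square_integrable_imp_integrable by blast+
  have cross: "integrable M (\<lambda>\<omega>. D i \<omega> * S \<omega>)" "expectation (\<lambda>\<omega>. D i \<omega> * S \<omega>) = 0"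
    using indep_var_integrable[OF indep int] indep_var_lebesgue_integral[OF indep int] D0
    by auto
  have split: "(\<Sum>j\<in>insert i I. D j \<omega>)\<^sup>2 = (D i \<omega>)\<^sup>2 + (S \<omega>)\<^sup>2 + 2 * (D i \<omega> * S \<omega>)" for \<omega>
    using insert.hyps by (simp add: S_def power2_sum)
  show ?case
    unfolding split using D2 IH cross insert.hyps by simp
qed

text \<open>
  By monotone convergence the series of the squared deviations has finite expectation. It is
  therefore almost surely finite, and then its terms tend to 0.
\<close>
lemma AE_tendsto_of_summable_second_moments:
  fixes Z :: "nat \<Rightarrow> 'a \<Rightarrow> real"
  assumes [measurable]: "\<And>k. Z k \<in> borel_measurable M"
    and int: "\<And>k. integrable M (\<lambda>\<omega>. (Z k \<omega> - \<mu>)\<^sup>2)"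
    and summable: "summable (\<lambda>k. expectation (\<lambda>\<omega>. (Z k \<omega> - \<mu>)\<^sup>2))"
  shows "AE \<omega> in M. (\<lambda>k. Z k \<omega>) \<longlonglongrightarrow> \<mu>"
proof -
  have "(\<integral>\<^sup>+\<omega>. (\<Sum>k. ennreal ((Z k \<omega> - \<mu>)\<^sup>2)) \<partial>M)
      = (\<Sum>k. ennreal (expectation (\<lambda>\<omega>. (Z k \<omega> - \<mu>)\<^sup>2)))"
    by (subst nn_integral_suminf) (auto simp: nn_integral_eq_integral int)
  also have "\<dots> = ennreal (\<Sum>k. expectation (\<lambda>\<omega>. (Z k \<omega> - \<mu>)\<^sup>2))"
    by (intro suminf_ennreal2 summable) simp
  finally have "(\<integral>\<^sup>+\<omega>. (\<Sum>k. ennreal ((Z k \<omega> - \<mu>)\<^sup>2)) \<partial>M) \<noteq> \<infinity>"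
    by simp
  then have "AE \<omega> in M. (\<Sum>k. ennreal ((Z k \<omega> - \<mu>)\<^sup>2)) \<noteq> \<infinity>"
    by (intro nn_integral_PInf_AE) auto
  then show ?thesis
  proof (rule AE_mp, intro AE_I2 impI)
    fix \<omega>
    assume "(\<Sum>k. ennreal ((Z k \<omega> - \<mu>)\<^sup>2)) \<noteq> \<infinity>"
    then have "summable (\<lambda>k. (Z k \<omega> - \<mu>)\<^sup>2)"
      by (intro summable_suminf_not_top) auto
    then have "(\<lambda>k. (Z k \<omega> - \<mu>)\<^sup>2) \<longlonglongrightarrow> 0"
      by (rule summable_LIMSEQ_zero)
    then have "(\<lambda>k. sqrt ((Z k \<omega> - \<mu>)\<^sup>2)) \<longlonglongrightarrow> sqrt 0"
      by (rule tendsto_real_sqrt)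
    then show "(\<lambda>k. Z k \<omega>) \<longlonglongrightarrow> \<mu>"
      by (simp add: LIM_zero_iff tendsto_rabs_zero_iff)
  qed
qed

text \<open>
  The lower bound \<open>b\<close> makes the partial sums of \<open>X i - b\<close> nondecreasing. This
  monotonicity is what extends convergence from the squares, where the variance bound
  \<open>V / n\<close> is summable, to all \<open>n\<close>.
\<close>
theorem strong_law_bounded_below:
  fixes X :: "nat \<Rightarrow> 'a \<Rightarrow> real"
  assumes indep: "indep_vars (\<lambda>_. borel) X {1..}"
    and square_int: "\<And>i. i \<ge> 1 \<Longrightarrow> integrable M (\<lambda>\<omega>. (X i \<omega>)\<^sup>2)"
    and mean: "\<And>i. i \<ge> 1 \<Longrightarrow> expectation (X i) = \<mu>"
    and var: "\<And>i. i \<ge> 1 \<Longrightarrow> variance (X i) \<le> V"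
    and below: "\<And>i \<omega>. i \<ge> 1 \<Longrightarrow> \<omega> \<in> space M \<Longrightarrow> b \<le> X i \<omega>"
  shows "AE \<omega> in M. (\<lambda>n. (\<Sum>i=1..n. X i \<omega>) / real n) \<longlonglongrightarrow> \<mu>"
proof -
  have rv: "X i \<in> borel_measurable M" if "i \<ge> 1" for i
    using indep that by (auto simp: indep_vars_def)
  have int: "integrable M (X i)" if "i \<ge> 1" for i
    using square_integrable_imp_integrable[OF rv square_int] that by blast
  have centered_int: "integrable M (\<lambda>\<omega>. (X i \<omega> - \<mu>)\<^sup>2)" if "i \<ge> 1" for i
    using int[OF that] square_int[OF that] by (simp add: power2_diff)
  have centered_indep: "indep_vars (\<lambda>_. borel) (\<lambda>i \<omega>. X i \<omega> - \<mu>) {1..}"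
    by (rule indep_vars_compose2[OF indep]) simp
  define avg where "avg n \<omega> = (\<Sum>i=1..n. X i \<omega>) / real n" for n \<omega>
  have deviation: "integrable M (\<lambda>\<omega>. (avg n \<omega> - \<mu>)\<^sup>2)
      \<and> expectation (\<lambda>\<omega>. (avg n \<omega> - \<mu>)\<^sup>2) \<le> V / real n" if "n \<ge> 1" for n
  proof -
    have eq: "(avg n \<omega> - \<mu>)\<^sup>2 = (\<Sum>i=1..n. X i \<omega> - \<mu>)\<^sup>2 / (real n)\<^sup>2" for \<omega>
    proof -
      have "avg n \<omega> - \<mu> = (\<Sum>i=1..n. X i \<omega> - \<mu>) / real n"
        using that by (simp add: avg_def sum_subtractf field_simps)
      then show ?thesis
        by (simp add: power_divide)
    qed
    have sum: "integrable M (\<lambda>\<omega>. (\<Sum>i=1..n. X i \<omega> - \<mu>)\<^sup>2)"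
      "expectation (\<lambda>\<omega>. (\<Sum>i=1..n. X i \<omega> - \<mu>)\<^sup>2) = (\<Sum>i=1..n. variance (X i))"
      using second_moment_sum_centered_indep[of "{1..n}" "\<lambda>i \<omega>. X i \<omega> - \<mu>"]
        indep_vars_subset[OF centered_indep, of "{1..n}"] centered_int int mean
      by (auto simp: prob_space)
    have "(\<Sum>i=1..n. variance (X i)) \<le> real n * V"
      using sum_bounded_above[of "{1..n}" "\<lambda>i. variance (X i)" V] var by simp
    then have "(\<Sum>i=1..n. variance (X i)) / (real n)\<^sup>2 \<le> V / real n"
      using that by (simp add: field_simps power2_eq_square)
    then show ?thesis
      unfolding eq using sum by simp
  qed
  \<comment> \<open>The squares start at 1 because \<open>avg 0\<close> is a division by zero.\<close>
  have "AE \<omega> in M. (\<lambda>k. avg ((Suc k)\<^sup>2) \<omega>) \<longlonglongrightarrow> \<mu>"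
  proof (rule AE_tendsto_of_summable_second_moments)
    show "avg ((Suc k)\<^sup>2) \<in> borel_measurable M" for k
      unfolding avg_def using rv by (intro borel_measurable_divide borel_measurable_sum) auto
    show "integrable M (\<lambda>\<omega>. (avg ((Suc k)\<^sup>2) \<omega> - \<mu>)\<^sup>2)" for k
      using deviation[of "(Suc k)\<^sup>2"] by simp
    have "summable (\<lambda>k. V * inverse (real (Suc k) ^ 2))"
      by (intro summable_mult) (subst summable_Suc_iff, rule inverse_power_summable, simp)
    then show "summable (\<lambda>k. expectation (\<lambda>\<omega>. (avg ((Suc k)\<^sup>2) \<omega> - \<mu>)\<^sup>2))"
    proof (rule summable_comparison_test_ev[rotated], intro always_eventually allI)
      fix k
      show "norm (expectation (\<lambda>\<omega>. (avg ((Suc k)\<^sup>2) \<omega> - \<mu>)\<^sup>2)) \<le> V * inverse (real (Suc k) ^ 2)"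
        using deviation[of "(Suc k)\<^sup>2"] by (simp add: field_simps del: of_nat_Suc)
    qed
  qed
  then show ?thesis
  proof (rule AE_mp, intro AE_I2 impI)
    fix \<omega>
    assume \<omega>: "\<omega> \<in> space M" and lim: "(\<lambda>k. avg ((Suc k)\<^sup>2) \<omega>) \<longlonglongrightarrow> \<mu>"
    define S where "S n = (\<Sum>i=1..n. X i \<omega> - b)" for n
    have S_avg: "S n / real n = avg n \<omega> - b" if "n \<ge> 1" for n
      using that by (simp add: S_def avg_def sum_subtractf field_simps)
    have "incseq S"
      by (rule incseq_SucI) (use below[OF _ \<omega>] in \<open>simp add: S_def\<close>)
    moreover have "(\<lambda>k. S (k\<^sup>2) / real (k\<^sup>2)) \<longlonglongrightarrow> \<mu> - b"
    proof (rule LIMSEQ_imp_Suc)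
      have "(\<lambda>k. avg ((Suc k)\<^sup>2) \<omega> - b) \<longlonglongrightarrow> \<mu> - b"
        by (intro tendsto_diff lim tendsto_const)
      then show "(\<lambda>k. S ((Suc k)\<^sup>2) / real ((Suc k)\<^sup>2)) \<longlonglongrightarrow> \<mu> - b"
        by (subst S_avg) auto
    qed
    moreover have "S 0 \<ge> 0"
      by (simp add: S_def)
    ultimately have "(\<lambda>n. S n / real n) \<longlonglongrightarrow> \<mu> - b"
      by (intro averages_tendsto_of_square_subsequence)
    then have "(\<lambda>n. S (Suc n) / real (Suc n) + b) \<longlonglongrightarrow> \<mu> - b + b"
      by (intro tendsto_add LIMSEQ_Suc[of "\<lambda>n. S n / real n"] tendsto_const)
    then have "(\<lambda>n. avg (Suc n) \<omega>) \<longlonglongrightarrow> \<mu>"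
      by (subst (asm) S_avg) auto
    then show "(\<lambda>n. (\<Sum>i=1..n. X i \<omega>) / real n) \<longlonglongrightarrow> \<mu>"
      unfolding avg_def by (rule LIMSEQ_imp_Suc)
  qed
qed

section \<open>Expectations with respect to the number of tosses\<close>

text \<open>
  The distribution \<open>geometric_pmf\<close> counts failures and starts at 0, hence the shift by
  \<open>Suc\<close>. The hypothesis is silent about the value 0; it is a null event because both
  measures have total mass 1 and agree on the positive numbers.
\<close>
lemma distr_tosses_eq_geometric:
  fixes K :: "'a \<Rightarrow> nat"
  assumes K[measurable]: "K \<in> measurable M (count_space UNIV)"
    and law: "\<And>n. n \<ge> 1 \<Longrightarrow> prob {\<omega> \<in> space M. K \<omega> = n} = (1/2) ^ n"
  shows "distr M (count_space UNIV) K = measure_pmf (map_pmf Suc (geometric_pmf (1/2)))"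
proof -
  interpret D: prob_space "distr M (count_space UNIV) K"
    by (rule prob_space_distr) measurable
  let ?G = "map_pmf Suc (geometric_pmf (1/2))"
  have sing: "D.prob {n} = pmf ?G n" if pos: "n \<ge> 1" for n
  proof -
    obtain m where n: "n = Suc m"
      using pos by (cases n) auto
    have "D.prob {n} = prob {\<omega> \<in> space M. K \<omega> = n}"
      by (subst measure_distr) (auto intro!: arg_cong[of _ _ prob])
    also have "\<dots> = pmf ?G n"
      using law[OF pos] by (simp add: n pmf_map_inj')
    finally show ?thesis .
  qed
  have pos: "D.prob {1..} = measure ?G {1..}"
  proof -
    have U: "(\<Union>n. {Suc n}) = {1..}"
      by (auto simp: Suc_le_eq gr0_conv_Suc)
    have "(\<lambda>n. D.prob {Suc n}) sums D.prob (\<Union>n. {Suc n})"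
      by (intro D.finite_measure_UNION) (auto simp: disjoint_family_on_def)
    moreover have "(\<lambda>n. measure ?G {Suc n}) sums measure ?G (\<Union>n. {Suc n})"
      by (intro measure_pmf.finite_measure_UNION) (auto simp: disjoint_family_on_def)
    ultimately show ?thesis
      unfolding U using sing sums_unique2 by (simp add: pmf.rep_eq)
  qed
  show ?thesis
  proof (rule measure_eqI_countable)
    fix n :: nat
    assume "n \<in> UNIV"
    have "D.prob {n} = measure ?G {n}"
    proof (cases "n = 0")
      case True
      have "D.prob (UNIV - {1..}) = measure ?G (UNIV - {1..})"
        using D.prob_compl[of "{1..}"] measure_pmf.prob_compl[where A = "{1::nat..}"] pos
        by (simp only: space_distr space_count_space space_measure_pmf sets_distr
            sets_count_space sets_measure_pmf Pow_UNIV UNIV_I True_implies_equals)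
      moreover have "UNIV - {1..} = {0::nat}"
        by auto
      ultimately show ?thesis
        by (simp only: True)
    next
      case False
      then show ?thesis
        using sing[of n] by (simp add: pmf.rep_eq)
    qed
    then show "emeasure (distr M (count_space UNIV) K) {n} = emeasure ?G {n}"
      by (simp add: D.emeasure_eq_measure measure_pmf.emeasure_eq_measure)
  qed auto
qed

text \<open>
  The law of \<open>K\<close> has density \<open>(1/2) ^ Suc n\<close> at \<open>Suc n\<close> with respect to
  counting measure, so integrals against it are series.
\<close>
lemma expectation_of_tosses:
  fixes K :: "'a \<Rightarrow> nat" and f :: "nat \<Rightarrow> real"
  assumes K[measurable]: "K \<in> measurable M (count_space UNIV)"
    and law: "\<And>n. n \<ge> 1 \<Longrightarrow> prob {\<omega> \<in> space M. K \<omega> = n} = (1/2) ^ n"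
    and summable: "summable (\<lambda>n. (1/2) ^ Suc n * \<bar>f (Suc n)\<bar>)"
  shows "integrable M (\<lambda>\<omega>. f (K \<omega>))"
    and "expectation (\<lambda>\<omega>. f (K \<omega>)) = (\<Sum>n. (1/2) ^ Suc n * f (Suc n))"
proof -
  let ?geo = "geometric_pmf (1/2)"
  have norm: "integrable (count_space UNIV) (\<lambda>n. (1/2) ^ Suc n * f (Suc n))"
    using summable by (simp add: integrable_count_space_nat_iff abs_mult)
  have dens: "measure_pmf ?geo = density (count_space UNIV) (\<lambda>n. ennreal ((1/2) ^ Suc n))"
    by (simp add: measure_pmf_eq_density)
  have int: "integrable ?geo (\<lambda>n. f (Suc n))"
    unfolding dens using norm by (subst integrable_density) auto
  have exp: "measure_pmf.expectation ?geo (\<lambda>n. f (Suc n)) = (\<Sum>n. (1/2) ^ Suc n * f (Suc n))"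
  proof -
    have "measure_pmf.expectation ?geo (\<lambda>n. f (Suc n))
        = (\<integral>n. (1/2) ^ Suc n * f (Suc n) \<partial>count_space UNIV)"
      unfolding dens by (subst integral_density) auto
    also have "\<dots> = (\<Sum>n. (1/2) ^ Suc n * f (Suc n))"
      by (rule integral_count_space_nat[OF norm])
    finally show ?thesis .
  qed
  have D: "distr M (count_space UNIV) K = distr ?geo (count_space UNIV) Suc"
    using distr_tosses_eq_geometric[OF K law] by (simp add: map_pmf_rep_eq)
  have "integrable (distr M (count_space UNIV) K) f"
    unfolding D using int by (subst integrable_distr_eq) auto
  then show "integrable M (\<lambda>\<omega>. f (K \<omega>))"
    by (subst (asm) integrable_distr_eq) auto
  have "expectation (\<lambda>\<omega>. f (K \<omega>)) = integral\<^sup>L (distr M (count_space UNIV) K) f"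
    by (subst integral_distr) auto
  also have "\<dots> = measure_pmf.expectation ?geo (\<lambda>n. f (Suc n))"
    unfolding D by (subst integral_distr) auto
  finally show "expectation (\<lambda>\<omega>. f (K \<omega>)) = (\<Sum>n. (1/2) ^ Suc n * f (Suc n))"
    using exp by simp
qed

end

text \<open>
  Since \<open>ln (d + 2 ^ n)\<close> is asymptotic to \<open>n * ln 2\<close>, the factor
  \<open>(1/2) ^ Suc n\<close> makes both terms \<open>O(1 / n\<^sup>2)\<close>.
\<close>
lemma summable_log_payout:
  fixes d :: real
  shows "summable (\<lambda>n. (1/2) ^ Suc n * \<bar>ln (d + 2 ^ n)\<bar>)"
    and "summable (\<lambda>n. (1/2) ^ Suc n * (ln (d + 2 ^ n))\<^sup>2)"
proof -
  \<comment> \<open>Writing the weight with base 2 matches the exponential inside the logarithm, so the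
    asymptotic comparison involves a single base.\<close>
  have half: "(1/2::real) ^ Suc n = inverse (2 * 2 ^ n)" for n
    by (simp add: power_one_over inverse_eq_divide)
  have inv_squares: "summable (\<lambda>n. norm (inverse (real n ^ 2)))"
    using inverse_power_summable[where 'a = real, of 2] by simp
  have "(\<lambda>n. inverse (2 * 2 ^ n) * \<bar>ln (d + 2 ^ n)\<bar>) \<in> O(\<lambda>n. inverse (real n ^ 2))"
    by real_asymp
  then show "summable (\<lambda>n. (1/2) ^ Suc n * \<bar>ln (d + 2 ^ n)\<bar>)"
    unfolding half by (rule summable_comparison_test_bigo[OF inv_squares])
  have "(\<lambda>n. inverse (2 * 2 ^ n) * (ln (d + 2 ^ n))\<^sup>2) \<in> O(\<lambda>n. inverse (real n ^ 2))"
    by real_asymp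
  then show "summable (\<lambda>n. (1/2) ^ Suc n * (ln (d + 2 ^ n))\<^sup>2)"
    unfolding half by (rule summable_comparison_test_bigo[OF inv_squares])
qed

section \<open>The growth rate of the lottery\<close>

lemma finite_time_avg_growth_factor_eq_exp:
  assumes "\<And>i. i \<ge> 1 \<Longrightarrow> r i > 0"
  shows "finite_time_avg_growth_factor r T = exp ((\<Sum>i=1..T. ln (r i)) / real T)"
proof -
  have "(\<Prod>i=1..T. r i) > 0"
    using assms by (intro prod_pos) auto
  moreover have "ln (\<Prod>i=1..T. r i) = (\<Sum>i=1..T. ln (r i))"
    using assms by (intro ln_prod) force+
  ultimately show ?thesis
    unfolding finite_time_avg_growth_factor_def powr_def by (simp del: prod_zero_iff)
qed

theorem theorem5p2:
  fixes M :: "'a measure" and N :: "nat \<Rightarrow> 'a \<Rightarrow> nat" and w c :: real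
  assumes "w > 0" and "c \<ge> 0" and "w - c + 1 > 0"
    and "prob_space M"
    and "prob_space.indep_vars M (\<lambda>_. count_space UNIV) N {1..}"
    and "\<And>i n. i \<ge> 1 \<Longrightarrow> n \<ge> 1 \<Longrightarrow> measure M {\<omega> \<in> space M. N i \<omega> = n} = (1/2) ^ n"
  shows "summable (\<lambda>n. (1/2) ^ Suc n * ln (w - c + 2 ^ (Suc n - 1)))
    \<and> (AE \<omega> in M.
          convergent (finite_time_avg_growth_factor (\<lambda>i. growth_factor w c (N i \<omega>)))
        \<and> time_avg_growth_factor (\<lambda>i. growth_factor w c (N i \<omega>)) > 0
        \<and> time_avg_growth_rate (\<lambda>i. growth_factor w c (N i \<omega>))
            = (\<Sum>n. (1/2) ^ Suc n * ln (w - c + 2 ^ (Suc n - 1))) - ln w)"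
proof -
  interpret prob_space M by fact
  \<comment> \<open>The constant \<open>ln w\<close> is split off, so that the mean is the series of the
    statement.\<close>
  define U where "U n = ln (w - c + payout n)" for n
  define g where "g = (\<Sum>n. (1/2) ^ Suc n * ln (w - c + 2 ^ (Suc n - 1)))"
  have wealth: "w - c + 1 \<le> w - c + payout n" for n
    by (simp add: payout_def)
  have U_Suc: "U (Suc n) = ln (w - c + 2 ^ n)" for n
    by (simp add: U_def payout_def)
  have abs_summable: "summable (\<lambda>n. (1/2) ^ Suc n * \<bar>U (Suc n)\<bar>)"
    and square_summable: "summable (\<lambda>n. (1/2) ^ Suc n * \<bar>(U (Suc n))\<^sup>2\<bar>)"
    unfolding U_Suc using summable_log_payout[of "w - c"] by simp_all
  have "summable (\<lambda>n. (1/2) ^ Suc n * U (Suc n))"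
    by (rule summable_norm_cancel) (use abs_summable in \<open>simp add: abs_mult\<close>)
  then have summable: "summable (\<lambda>n. (1/2) ^ Suc n * ln (w - c + 2 ^ (Suc n - 1)))"
    by (simp add: U_Suc)
  have rv: "N i \<in> measurable M (count_space UNIV)" if "i \<ge> 1" for i
    using assms(5) that by (auto simp: indep_vars_def)
  have mean: "expectation (\<lambda>\<omega>. U (N i \<omega>)) = g" if "i \<ge> 1" for i
    using expectation_of_tosses(2)[OF rv[OF that] assms(6)[OF that] abs_summable]
    by (simp add: g_def U_Suc)
  have int: "integrable M (\<lambda>\<omega>. U (N i \<omega>))" if "i \<ge> 1" for i
    by (rule expectation_of_tosses(1)[OF rv[OF that] assms(6)[OF that] abs_summable])
  note square = expectation_of_tosses[OF rv assms(6) square_summable]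
  have "AE \<omega> in M. (\<lambda>n. (\<Sum>i=1..n. U (N i \<omega>)) / real n) \<longlonglongrightarrow> g"
  proof (rule strong_law_bounded_below)
    show "indep_vars (\<lambda>_. borel) (\<lambda>i \<omega>. U (N i \<omega>)) {1..}"
      by (rule indep_vars_compose2[OF assms(5)]) simp
    show "variance (\<lambda>\<omega>. U (N i \<omega>)) \<le> (\<Sum>n. (1/2) ^ Suc n * (U (Suc n))\<^sup>2)" if "i \<ge> 1" for i
      using variance_eq[OF int square(1)] square(2) that by simp
    show "ln (w - c + 1) \<le> U (N i \<omega>)" for i \<omega>
      unfolding U_def using assms(3) wealth by (subst ln_le_cancel_iff) (auto intro: less_le_trans)
  qed (use square(1) mean in auto)
  then have "AE \<omega> in M.
          convergent (finite_time_avg_growth_factor (\<lambda>i. growth_factor w c (N i \<omega>)))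
        \<and> time_avg_growth_factor (\<lambda>i. growth_factor w c (N i \<omega>)) > 0
        \<and> time_avg_growth_rate (\<lambda>i. growth_factor w c (N i \<omega>)) = g - ln w"
  proof (rule AE_mp, intro AE_I2 impI)
    fix \<omega>
    assume lim: "(\<lambda>n. (\<Sum>i=1..n. U (N i \<omega>)) / real n) \<longlonglongrightarrow> g"
    define r where "r i = growth_factor w c (N i \<omega>)" for i
    have pos: "w - c + payout n > 0" for n
      using wealth[of n] assms(3) by linarith
    then have r_pos: "r i > 0" for i
      using assms(1) by (simp add: r_def growth_factor_def)
    have ln_r: "ln (r i) = U (N i \<omega>) - ln w" for i
      using pos[of "N i \<omega>"] assms(1) by (simp add: r_def growth_factor_def U_def ln_div)
    have avg: "(\<Sum>i=1..Suc n. ln (r i)) / real (Suc n)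
        = (\<Sum>i=1..Suc n. U (N i \<omega>)) / real (Suc n) - ln w" for n
      unfolding ln_r sum_subtractf
      by (simp add: diff_divide_distrib del: of_nat_Suc sum.cl_ivl_Suc)
    have "(\<lambda>n. (\<Sum>i=1..Suc n. U (N i \<omega>)) / real (Suc n) - ln w) \<longlonglongrightarrow> g - ln w"
      by (intro tendsto_diff LIMSEQ_Suc[OF lim] tendsto_const)
    then have "(\<lambda>n. (\<Sum>i=1..n. ln (r i)) / real n) \<longlonglongrightarrow> g - ln w"
      unfolding avg[symmetric] by (rule LIMSEQ_imp_Suc)
    then have "(\<lambda>n. exp ((\<Sum>i=1..n. ln (r i)) / real n)) \<longlonglongrightarrow> exp (g - ln w)"
      by (rule tendsto_exp)
    then have conv: "finite_time_avg_growth_factor r \<longlonglongrightarrow> exp (g - ln w)"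
      using finite_time_avg_growth_factor_eq_exp[of r] r_pos by presburger
    then have "time_avg_growth_factor r = exp (g - ln w)"
      unfolding time_avg_growth_factor_def by (rule limI)
    then have "convergent (finite_time_avg_growth_factor r) \<and> time_avg_growth_factor r > 0
        \<and> time_avg_growth_rate r = g - ln w"
      using conv by (auto simp: convergent_def time_avg_growth_rate_def)
    then show "convergent (finite_time_avg_growth_factor (\<lambda>i. growth_factor w c (N i \<omega>)))
        \<and> time_avg_growth_factor (\<lambda>i. growth_factor w c (N i \<omega>)) > 0
        \<and> time_avg_growth_rate (\<lambda>i. growth_factor w c (N i \<omega>)) = g - ln w"
      unfolding r_def .
  qed
  then show ?thesis
    using summable unfolding g_def by blast
qed

end
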